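(* Let $B=5$, let $\tilde p<0$ be an integer and $\tilde q$ a positive integer with $\tilde q\geqslant 3600\sqrt[3]{|\tilde p|}$. Let $F_1=B^{2}\tilde q^{6}+2B\tilde q^{4}-2B\tilde p\tilde q^{3}-2\tilde q^{2}-2\tilde p\tilde q+\tilde p^{2}+\frac5B-\frac{20}{B^{2}\tilde q^{2}}$. Then there is no integer $t$ with $F_1+\frac{10\tilde p}{B^{2}\tilde q^{3}}<t<F_1$. *)

theory Defs
  imports Complex_Main
begin

definition F1 :: "real \<Rightarrow> int \<Rightarrow> int \<Rightarrow> real" where
  "F1 B p q =
     B^2 * of_int q ^ 6 + 2 * B * of_int q ^ 4 - 2 * B * of_int p * of_int q ^ 3
     - 2 * of_int q ^ 2 - 2 * of_int p * of_int q + of_int p ^ 2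
     + 5 / B - 20 / (B^2 * of_int q ^ 2)"

end

theory Submission
  imports Defs
begin

text \<open>For \<open>B = 5\<close> every term of \<open>F1\<close> except the last is an integer, so \<open>F1\<close> lies
  \<open>4 / (5 q\<^sup>2)\<close> below an integer. The cube-root bound gives \<open>q \<ge> 3600\<close> and
  \<open>\<bar>p\<bar> \<le> q\<^sup>3\<close>, so the interval below \<open>F1\<close> has length at most \<open>2/5\<close> and stays
  strictly between two consecutive integers.\<close>

theorem theorem7p2:
  fixes B :: real and p q :: int
  assumes "B = 5"
    and "p < 0"
    and "q > 0"
    and "of_int q \<ge> 3600 * root 3 \<bar>of_int p\<bar>"
  shows "\<not> (\<exists>t::int. F1 B p q + 10 * of_int p / (B^2 * of_int q ^ 3) < of_int t
                      \<and> of_int t < F1 B p q)"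
proof
  assume "\<exists>t::int. F1 B p q + 10 * of_int p / (B^2 * of_int q ^ 3) < of_int t
                      \<and> of_int t < F1 B p q"
  then obtain t :: int
    where lower: "F1 B p q + 10 * of_int p / (B^2 * of_int q ^ 3) < of_int t"
      and upper: "of_int t < F1 B p q"
    by blast
  define r where "r = root 3 \<bar>real_of_int p\<bar>"
  have r3: "r ^ 3 = \<bar>real_of_int p\<bar>"
    unfolding r_def by (simp add: odd_real_root_pow)
  \<comment> \<open>A negative integer has absolute value at least 1, hence so does its cube root;
    then 3600 * \<open>r\<close> \<le> \<open>q\<close> yields both bounds on
    \<open>q\<close>.\<close>
  have "1 \<le> r"
    unfolding r_def using assms(2) by simp
  then have q_ge: "3600 \<le> real_of_int q" and "r \<le> real_of_int q"
    using assms(4)[folded r_def] by linarith+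
  then have "r ^ 3 \<le> real_of_int q ^ 3"
    using \<open>1 \<le> r\<close> by (intro power_mono) simp_all
  then have "- (real_of_int q ^ 3) \<le> real_of_int p"
    using r3 by linarith
  then have length: "- (2 / 5) \<le> 10 * real_of_int p / (B^2 * real_of_int q ^ 3)"
    using assms(3) by (simp add: assms(1) le_divide_eq)
  \<comment> \<open>The target 3/5 is 1 - 2/5, what \<open>length\<close> leaves of a unit interval,
    so the lower endpoint stays above \<open>N\<close>.\<close>
  have "2 ^ 2 \<le> real_of_int q ^ 2"
    using q_ge by (intro power_mono) simp_all
  then have gap: "4 / (5 * real_of_int q ^ 2) < 3 / 5"
    using assms(3) by (simp add: divide_less_eq)
  define N :: int
    where "N = 25 * q ^ 6 + 10 * q ^ 4 - 10 * p * q ^ 3 - 2 * q ^ 2 - 2 * p * q + p ^ 2"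
  \<comment> \<open>At \<open>B = 5\<close> the term \<open>5 / B\<close> is the 1, and 20/25 =
    4/5.\<close>
  have F1_eq: "F1 B p q = of_int N + 1 - 4 / (5 * real_of_int q ^ 2)"
    unfolding F1_def N_def assms(1) by simp
  have "0 < 4 / (5 * real_of_int q ^ 2)"
    using assms(3) by simp
  then have "real_of_int t < real_of_int (N + 1)"
    using upper F1_eq by linarith
  moreover have "real_of_int N < real_of_int t"
    using lower F1_eq length gap by linarith
  ultimately show False
    unfolding of_int_less_iff by linarith
qed

end
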